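(* Let $k$ be a field, $A$ a (finite dimensional) Frobenius $k$-algebra, $\varphi\colon A\to k$ a Frobenius homomorphism and $\rho\colon A\to A$ the Nakayama automorphism of $A$ with respect to $\varphi$. Assume that $\rho$ has finite order $m=\operatorname{ord}_\rho$ and that $k$ has a primitive $m$-th root of unity $w$. Let $\operatorname{HH}^n(A)=\bigoplus_{i=0}^{m-1}\operatorname{HH}^n_i(A)$ be the decomposition of Hochschild cohomology induced by the grading $A=A_0\oplus\cdots\oplus A_{m-1}$, $A_i=\{a\in A:\rho(a)=w^ia\}$. Then $$\operatorname{HH}^n(A)=\operatorname{HH}^n_0(A)\quad\text{for all } n\ge 0.$$
   Context: Let $A$ be a finite dimensional $k$-algebra and let $DA=\operatorname{Hom}_k(A,k)$ with its usual $A$-bimodule structure: $(x f)(a)=f(ax)$ and $(f x)(a)=f(xa)$ for $f\in DA$, $x,a\in A$. $A$ is a Frobenius algebra if there is a linear form $\varphi\colon A\to k$ (a Frobenius homomorphism) such that $A\to DA$, $x\mapsto x\varphi$, is an isomorphism of left $A$-modules; equivalently $x\mapsto\varphi x$ is an isomorphism of right $A$-modules. The Nakayama automorphism of $A$ with respect to $\varphi$ is the algebra automorphism $\rho$ of $A$ determined by $x\varphi=\varphi\rho(x)$ for all $x\in A$. It has order $m\in\mathbb N$ (written $\operatorname{ord}_\rho=m$) if $\rho^m=\mathrm{id}_A$ and $\rho^r\neq\mathrm{id}_A$ for all $1\le r<m$. If $\rho$ has finite order $m$ and $w\in k$ is a primitive $m$-th root of unity, then $A=A_0\oplus\cdots\oplus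 A_{m-1}$ is a $\mathbb Z/m\mathbb Z$-graded algebra, where $A_i=\{a\in A:\rho(a)=w^ia\}$. Let $(\operatorname{Hom}_k(A^{\otimes *},A),b^* )$ be the Hochschild cochain complex of $A$ with coefficients in $A$, with cohomology $\operatorname{HH}^*(A)$. For $0\le i<m$ let $$\operatorname{Hom}_k(A^{\otimes n},A)_i=\bigoplus \operatorname{Hom}_k(A_{u_1}\otimes\cdots\otimes A_{u_n},A_v),$$ the sum being over all $(u_1,\dots,u_n,v)\in\{0,\dots,m-1\}^{n+1}$ with $v-u_1-\cdots-u_n\equiv i\pmod m$. These form subcomplexes, the Hochschild complex is their direct sum, and $\operatorname{HH}^n_i(A)=H^n(\operatorname{Hom}_k(A^{\otimes *},A)_i,b^* )$, so that $\operatorname{HH}^n(A)=\bigoplus_{i=0}^{m-1}\operatorname{HH}^n_i(A)$. *)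

theory Defs
  imports Complex_Main
    "HOL-Library.Function_Algebras"
    "HOL-Library.Set_Algebras"
    "HOL-Number_Theory.Cong"
begin

(* The class ring_1 would demand 0 ~= 1; the sort {ring, monoid_mult} describes
   unital associative rings and keeps the zero algebra. *)
locale finite_dimensional_algebra = vector_space scale
  for scale :: "'k::field \<Rightarrow> 'a::{ring, monoid_mult} \<Rightarrow> 'a" +
  assumes scale_mult_left: "scale c x * y = scale c (x * y)"
    and scale_mult_right: "x * scale c y = scale c (x * y)"
    and finite_dimensional: "\<exists>B. finite B \<and> span B = UNIV"

definition dual :: "('k::field \<Rightarrow> 'a::{ring, monoid_mult} \<Rightarrow> 'a) \<Rightarrow> ('a \<Rightarrow> 'k) set" where
  "dual scale = {f. Vector_Spaces.linear scale (*) f}"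

definition left_act :: "'a::{ring, monoid_mult} \<Rightarrow> ('a \<Rightarrow> 'k) \<Rightarrow> 'a \<Rightarrow> 'k" where
  "left_act x f = (\<lambda>a. f (a * x))"

definition right_act :: "('a::{ring, monoid_mult} \<Rightarrow> 'k) \<Rightarrow> 'a \<Rightarrow> 'a \<Rightarrow> 'k" where
  "right_act f x = (\<lambda>a. f (x * a))"

(* Compatibility with scalars follows from A-linearity, since c x = (c 1) x. *)
definition left_module_iso_dual ::
  "('k::field \<Rightarrow> 'a::{ring, monoid_mult} \<Rightarrow> 'a) \<Rightarrow> ('a \<Rightarrow> 'a \<Rightarrow> 'k) \<Rightarrow> bool" where
  "left_module_iso_dual scale F \<longleftrightarrow>
     bij_betw F UNIV (dual scale) \<and>
     (\<forall>x y. F (x + y) = F x + F y) \<and>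
     (\<forall>x y. F (x * y) = left_act x (F y))"

definition frobenius_homomorphism ::
  "('k::field \<Rightarrow> 'a::{ring, monoid_mult} \<Rightarrow> 'a) \<Rightarrow> ('a \<Rightarrow> 'k) \<Rightarrow> bool" where
  "frobenius_homomorphism scale \<phi> \<longleftrightarrow>
     \<phi> \<in> dual scale \<and> left_module_iso_dual scale (\<lambda>x. left_act x \<phi>)"

definition algebra_automorphism ::
  "('k::field \<Rightarrow> 'a::{ring, monoid_mult} \<Rightarrow> 'a) \<Rightarrow> ('a \<Rightarrow> 'a) \<Rightarrow> bool" where
  "algebra_automorphism scale \<rho> \<longleftrightarrow>
     Vector_Spaces.linear scale scale \<rho> \<and> bij \<rho> \<and> \<rho> 1 = 1 \<and> (\<forall>x y. \<rho> (x * y) = \<rho> x * \<rho> y)"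

definition nakayama_automorphism ::
  "('k::field \<Rightarrow> 'a::{ring, monoid_mult} \<Rightarrow> 'a) \<Rightarrow> ('a \<Rightarrow> 'k) \<Rightarrow> ('a \<Rightarrow> 'a) \<Rightarrow> bool" where
  "nakayama_automorphism scale \<phi> \<rho> \<longleftrightarrow>
     algebra_automorphism scale \<rho> \<and> (\<forall>x. left_act x \<phi> = right_act \<phi> (\<rho> x))"

definition has_order :: "('a \<Rightarrow> 'a) \<Rightarrow> nat \<Rightarrow> bool" where
  "has_order \<rho> m \<longleftrightarrow> 1 \<le> m \<and> \<rho> ^^ m = id \<and> (\<forall>r. 1 \<le> r \<and> r < m \<longrightarrow> \<rho> ^^ r \<noteq> id)"

definition primitive_root_of_unity :: "nat \<Rightarrow> 'k::field \<Rightarrow> bool" where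
  "primitive_root_of_unity m w \<longleftrightarrow> 1 \<le> m \<and> w ^ m = 1 \<and> (\<forall>r. 1 \<le> r \<and> r < m \<longrightarrow> w ^ r \<noteq> 1)"

definition graded_part ::
  "('k::field \<Rightarrow> 'a::{ring, monoid_mult} \<Rightarrow> 'a) \<Rightarrow> ('a \<Rightarrow> 'a) \<Rightarrow> 'k \<Rightarrow> nat \<Rightarrow> 'a set" where
  "graded_part scale \<rho> w i = {a. \<rho> a = scale (w ^ i) a}"

(* A linear map on the n-th tensor power is encoded as the corresponding n-linear map, taking
   its arguments as a list of length n. The value 0 on all other lists makes the encoding
   unique, so that equality of cochains is equality of functions. *)
definition cochains ::
  "('k::field \<Rightarrow> 'a::{ring, monoid_mult} \<Rightarrow> 'a) \<Rightarrow> nat \<Rightarrow> ('a list \<Rightarrow> 'a) set" where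
  "cochains scale n =
     {f. (\<forall>xs. length xs \<noteq> n \<longrightarrow> f xs = 0) \<and>
         (\<forall>xs i. length xs = n \<and> i < n \<longrightarrow>
            Vector_Spaces.linear scale scale (\<lambda>x. f (xs[i := x])))}"

(* On xs = [a_0, ..., a_n] the i-th summand is (-1)^(i+1) f(a_0, ..., a_i a_(i+1), ..., a_n). *)
definition hochschild_differential ::
  "('k::field \<Rightarrow> 'a::{ring, monoid_mult} \<Rightarrow> 'a) \<Rightarrow> nat \<Rightarrow> ('a list \<Rightarrow> 'a) \<Rightarrow> 'a list \<Rightarrow> 'a" where
  "hochschild_differential scale n f = (\<lambda>xs.
     if length xs = Suc n then
       hd xs * f (tl xs)
       + (\<Sum>i<n. scale ((-1) ^ Suc i)
            (f (take i xs @ (xs ! i * xs ! Suc i) # drop (Suc (Suc i)) xs)))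
       + scale ((-1) ^ Suc n) (f (butlast xs) * last xs)
     else 0)"

(* Hom(A_(u_1) (x) ... (x) A_(u_n), A_v) inside Hom(A^(x n), A): a map on one homogeneous
   summand is extended by zero to the other summands. *)
definition homogeneous_component ::
  "('k::field \<Rightarrow> 'a::{ring, monoid_mult} \<Rightarrow> 'a) \<Rightarrow> ('a \<Rightarrow> 'a) \<Rightarrow> 'k \<Rightarrow> nat \<Rightarrow> nat list \<Rightarrow> nat
    \<Rightarrow> ('a list \<Rightarrow> 'a) set" where
  "homogeneous_component scale \<rho> w m us v =
     {f \<in> cochains scale (length us).
        \<forall>us' xs. length us' = length us \<and> set us' \<subseteq> {..<m} \<and>
                 list_all2 (\<lambda>x u. x \<in> graded_part scale \<rho> w u) xs us' \<longrightarrow>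
                 (if us' = us then f xs \<in> graded_part scale \<rho> w v else f xs = 0)}"

definition degree_indices :: "nat \<Rightarrow> nat \<Rightarrow> nat \<Rightarrow> (nat list \<times> nat) set" where
  "degree_indices m i n =
     {(us, v). length us = n \<and> set us \<subseteq> {..<m} \<and> v < m \<and>
               [int v - (\<Sum>u\<leftarrow>us. int u) = int i] (mod int m)}"

definition cochains_deg ::
  "('k::field \<Rightarrow> 'a::{ring, monoid_mult} \<Rightarrow> 'a) \<Rightarrow> ('a \<Rightarrow> 'a) \<Rightarrow> 'k \<Rightarrow> nat \<Rightarrow> nat \<Rightarrow> nat
    \<Rightarrow> ('a list \<Rightarrow> 'a) set" where
  "cochains_deg scale \<rho> w m i n =
     {f. \<exists>g. (\<forall>(us, v) \<in> degree_indices m i n. g us v \<in> homogeneous_component scale \<rho> w m us v) \<and>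
             f = (\<lambda>xs. \<Sum>(us, v) \<in> degree_indices m i n. g us v xs)}"

(* Below, C is a subcomplex of the Hochschild cochain complex: C n is its space of n-cochains. *)

definition cocycles ::
  "('k::field \<Rightarrow> 'a::{ring, monoid_mult} \<Rightarrow> 'a) \<Rightarrow> (nat \<Rightarrow> ('a list \<Rightarrow> 'a) set) \<Rightarrow> nat
    \<Rightarrow> ('a list \<Rightarrow> 'a) set" where
  "cocycles scale C n = {f \<in> C n. hochschild_differential scale n f = 0}"

fun coboundaries ::
  "('k::field \<Rightarrow> 'a::{ring, monoid_mult} \<Rightarrow> 'a) \<Rightarrow> (nat \<Rightarrow> ('a list \<Rightarrow> 'a) set) \<Rightarrow> nat
    \<Rightarrow> ('a list \<Rightarrow> 'a) set" where
  "coboundaries scale C 0 = {0}"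
| "coboundaries scale C (Suc n) = hochschild_differential scale n ` C n"

(* The quotient of cocycles by coboundaries, as a set of cosets. The sum of two classes is their
   elementwise sum S + T; in scalar multiples the coboundaries are added again because
   multiplication by 0 collapses a coset to a point. *)
definition cohomology ::
  "('k::field \<Rightarrow> 'a::{ring, monoid_mult} \<Rightarrow> 'a) \<Rightarrow> (nat \<Rightarrow> ('a list \<Rightarrow> 'a) set) \<Rightarrow> nat
    \<Rightarrow> ('a list \<Rightarrow> 'a) set set" where
  "cohomology scale C n = (\<lambda>f. f +o coboundaries scale C n) ` cocycles scale C n"

definition class_scale ::
  "('k::field \<Rightarrow> 'a::{ring, monoid_mult} \<Rightarrow> 'a) \<Rightarrow> (nat \<Rightarrow> ('a list \<Rightarrow> 'a) set) \<Rightarrow> nat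
    \<Rightarrow> 'k \<Rightarrow> ('a list \<Rightarrow> 'a) set \<Rightarrow> ('a list \<Rightarrow> 'a) set" where
  "class_scale scale C n c S = (\<lambda>f xs. scale c (f xs)) ` S + coboundaries scale C n"

(* For a subcomplex C of C', the map H^n(C) -> H^n(C') induced by the inclusion: it enlarges a
   coset of the coboundaries of C to the coset of the coboundaries of C' that contains it. *)
definition inclusion_map ::
  "('k::field \<Rightarrow> 'a::{ring, monoid_mult} \<Rightarrow> 'a) \<Rightarrow> (nat \<Rightarrow> ('a list \<Rightarrow> 'a) set) \<Rightarrow> nat
    \<Rightarrow> ('a list \<Rightarrow> 'a) set \<Rightarrow> ('a list \<Rightarrow> 'a) set" where
  "inclusion_map scale C' n S = S + coboundaries scale C' n"

definition cohomology_iso ::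
  "('k::field \<Rightarrow> 'a::{ring, monoid_mult} \<Rightarrow> 'a) \<Rightarrow> (nat \<Rightarrow> ('a list \<Rightarrow> 'a) set)
    \<Rightarrow> (nat \<Rightarrow> ('a list \<Rightarrow> 'a) set) \<Rightarrow> nat
    \<Rightarrow> (('a list \<Rightarrow> 'a) set \<Rightarrow> ('a list \<Rightarrow> 'a) set) \<Rightarrow> bool" where
  "cohomology_iso scale C C' n F \<longleftrightarrow>
     bij_betw F (cohomology scale C n) (cohomology scale C' n) \<and>
     (\<forall>S \<in> cohomology scale C n. \<forall>T \<in> cohomology scale C n. F (S + T) = F S + F T) \<and>
     (\<forall>c. \<forall>S \<in> cohomology scale C n.
        F (class_scale scale C n c S) = class_scale scale C' n c (F S))"

end

theory Submission
  imports Defs "HOL-Computational_Algebra.Polynomial"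
begin

text \<open>
  The automorphism \<open>\<rho>\<close> acts on Hochschild cochains by conjugation,
  \<open>f \<mapsto> \<rho>\<^sup>-\<^sup>1 \<circ> f \<circ> (\<rho> \<otimes> \<dots> \<otimes> \<rho>)\<close>, and this action is multiplication by a power of \<open>w\<close>
  on each homogeneous piece: a cochain of degree \<open>i\<close> is scaled by \<open>w\<close> to the power \<open>-i\<close>. So the part of
  degree \<open>0\<close> consists of the invariant cochains (\<open>cochains_deg_0\<close>), and the theorem says that
  every class has an invariant representative and that an invariant coboundary is the coboundary of
  an invariant cochain. Both follow by averaging over the powers of \<open>\<rho>\<close>, once it is known
  that \<open>\<rho>\<close> acts trivially on cohomology. Averaging is possible because a field with a primitive
  \<open>m\<close>-th root of unity has \<open>m \<noteq> 0\<close>.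

  That \<open>\<rho>\<close> acts trivially (\<open>twist_cocycle_cohomologous\<close>) is where the Frobenius form enters. It
  turns a cochain \<open>f\<close> with \<open>n\<close> arguments into the form
  \<open>F(a\<^sub>0, \<dots>, a\<^sub>n) = \<phi>(a\<^sub>0 f(a\<^sub>1, \<dots>, a\<^sub>n))\<close>. Since \<open>\<phi>(a x) = \<phi>(\<rho>(x) a)\<close>, the last term of the
  Hochschild differential becomes \<open>\<plusminus>F(\<rho>(a\<^sub>n\<^sub>+\<^sub>1) a\<^sub>0, a\<^sub>1, \<dots>, a\<^sub>n)\<close>: in terms of forms, the
  differential contracts each of the cyclically neighbouring pairs of a word, with a twist by \<open>\<rho>\<close>
  at the place where the word closes up. Such forms carry the signed rotation
  \<open>(tF)(a\<^sub>0, \<dots>, a\<^sub>n) = (-1)\<^sup>n F(\<rho>(a\<^sub>n), a\<^sub>0, \<dots>, a\<^sub>n\<^sub>-\<^sub>1)\<close>, whose full power \<open>T\<close> of exponent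
  \<open>n + 1\<close> applies \<open>\<rho>\<close> to every argument and hence corresponds to the conjugation of \<open>f\<close>.

  Connes' operator gives a null-homotopy of \<open>1 - T\<close>. Let \<open>b\<close> be the differential, \<open>b'\<close> the same sum
  without its last term, \<open>(sF)(x) = F(1, x)\<close>, and \<open>N = 1 + t + \<dots> + t\<^sup>n\<close>. Then
  \<open>b's + sb' = 1\<close>, \<open>(1 - t)b = b'(1 - t)\<close>, \<open>Nb' = bN\<close> and \<open>N(1 - t) = 1 - T\<close>, so that a form \<open>F\<close>
  with \<open>bF = 0\<close> satisfies \<open>(1 - T)F = N(b's + sb')(1 - t)F = bNs(1 - t)F\<close>. Non-degeneracy of
  \<open>\<phi>\<close> turns the form \<open>Ns(1 - t)F\<close> back into a cochain.
\<close>

section \<open>Rotating and contracting cyclic words\<close>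

locale multiplicative_map =
  fixes \<rho> :: "'a::monoid_mult \<Rightarrow> 'a"
  assumes map_mult: "\<rho> (x * y) = \<rho> x * \<rho> y"
begin

definition rot :: "'a list \<Rightarrow> 'a list" where
  "rot xs = \<rho> (last xs) # butlast xs"

text \<open>The words are cyclic: the last index contracts the last letter with the first one, and
  \<open>\<rho>\<close> is applied to the letter that is carried around.\<close>

definition contract :: "nat \<Rightarrow> 'a list \<Rightarrow> 'a list" where
  "contract i xs =
     (if Suc i < length xs then take i xs @ (xs ! i * xs ! Suc i) # drop (Suc (Suc i)) xs
      else (\<rho> (last xs) * hd xs) # butlast (tl xs))"

lemma length_rot [simp]: "xs \<noteq> [] \<Longrightarrow> length (rot xs) = length xs"
  by (simp add: rot_def)

lemma length_funpow_rot [simp]: "xs \<noteq> [] \<Longrightarrow> length ((rot ^^ j) xs) = length xs"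
proof (induction j)
  case (Suc j)
  then have "(rot ^^ j) xs \<noteq> []" by (metis length_0_conv)
  with Suc show ?case by simp
qed simp

lemma length_contract: "2 \<le> length xs \<Longrightarrow> length (contract i xs) = length xs - 1"
  by (auto simp: contract_def)

text \<open>The two commutation rules below are the relations of a paracyclic module, read on words.
  The first letter of a rotated word is the twisted old last one, so contracting it with its successor
  is the contraction that closes the original word.\<close>

lemma contract_0_rot:
  assumes "length xs = Suc (Suc n)"
  shows "contract 0 (rot xs) = contract (Suc n) xs"
proof -
  obtain x ys where xs: "xs = x # ys" using assms by (cases xs) auto
  with assms have "ys \<noteq> []" by auto
  then obtain us z where "ys = us @ [z]" by (metis rev_exhaust)
  with xs assms show ?thesis by (simp add: contract_def rot_def butlast_append)
qed

lemma contract_Suc_rot: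
  assumes "Suc i < length xs"
  shows "contract (Suc i) (rot xs) = rot (contract i xs)"
proof -
  from assms obtain ys z where xs: "xs = ys @ [z]"
    by (metis length_0_conv not_less_zero rev_exhaust)
  show ?thesis
  proof (cases "Suc i < length ys")
    case True
    then show ?thesis
      by (simp add: xs contract_def rot_def nth_append butlast_append)
  next
    case False
    with assms xs have len: "length ys = Suc i" by simp
    then obtain us y where "ys = us @ [y]" by (metis length_Suc_conv rev_exhaust list.distinct(1))
    with len show ?thesis
      by (simp add: xs contract_def rot_def nth_append butlast_append map_mult)
  qed
qed

lemma contract_rot_funpow:
  assumes "i < length xs" "j \<le> i"
  shows "contract i ((rot ^^ j) xs) = (rot ^^ j) (contract (i - j) xs)"
  using assms
proof (induction j arbitrary: i)
  case (Suc j)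
  then obtain i' where i: "i = Suc i'" by (cases i) auto
  have "xs \<noteq> []" using Suc.prems by auto
  then show ?case using Suc by (simp add: i contract_Suc_rot)
qed simp

text \<open>After more than \<open>i\<close> rotations the pair at place \<open>i\<close> has been carried through the place where the
  word closes up. Its two letters need two rotations for that, the contracted letter only one, so the
  contracted word is rotated once less.\<close>

lemma contract_rot_funpow_wrap:
  assumes "length xs = Suc (Suc n)" "i \<le> n" "q \<le> Suc n"
  shows "contract i ((rot ^^ (i + Suc q)) xs) = (rot ^^ (i + q)) (contract (Suc n - q) xs)"
proof -
  have ne: "xs \<noteq> []" using assms by auto
  have "contract i ((rot ^^ (i + Suc q)) xs) = contract i ((rot ^^ i) (rot ((rot ^^ q) xs)))"
    by (simp add: funpow_add flip: funpow_swap1)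
  also have "\<dots> = (rot ^^ i) (contract 0 (rot ((rot ^^ q) xs)))"
    using contract_rot_funpow[of i "rot ((rot ^^ q) xs)" i] assms ne
    by (metis (no_types, lifting) diff_self_eq_0 dual_order.refl funpow.simps(2) le_SucI
        le_imp_less_Suc length_funpow_rot o_apply)
  also have "\<dots> = (rot ^^ i) (contract (Suc n) ((rot ^^ q) xs))"
    using assms ne by (simp add: contract_0_rot)
  also have "\<dots> = (rot ^^ i) ((rot ^^ q) (contract (Suc n - q) xs))"
    using assms by (simp add: contract_rot_funpow)
  finally show ?thesis by (simp add: funpow_add)
qed

lemma rot_funpow_prefix:
  assumes "length ys = j"
  shows "(rot ^^ j) (xs @ ys) = map \<rho> ys @ xs"
  using assms
proof (induction j arbitrary: xs ys)
  case (Suc j)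
  then obtain y ys' where y: "ys = y # ys'" by (cases ys) auto
  then have "(rot ^^ j) (xs @ ys) = map \<rho> ys' @ xs @ [y]"
    using Suc.IH[of ys' "xs @ [y]"] Suc.prems by simp
  then have "(rot ^^ Suc j) (xs @ ys) = rot (map \<rho> ys' @ xs @ [y])" by simp
  also have "\<dots> = map \<rho> ys @ xs" by (simp add: y rot_def butlast_append)
  finally show ?case .
qed simp

lemma rot_funpow_length: "(rot ^^ length xs) xs = map \<rho> xs"
  using rot_funpow_prefix[of xs _ "[]"] by simp

text \<open>The operators \<open>b\<close>, \<open>b'\<close>, \<open>1 - t\<close>, \<open>N\<close> and \<open>s\<close>, in this order. They act on functions of words of all
  lengths at once, and a value of the result at a word of length \<open>n + 1\<close> involves \<open>F\<close> on words of length \<open>n\<close>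
  for \<open>b\<close> and \<open>b'\<close>, of length \<open>n + 1\<close> for \<open>1 - t\<close> and \<open>N\<close>, and of length \<open>n + 2\<close> for \<open>s\<close>.\<close>

definition cyclic_diff :: "('a list \<Rightarrow> 'r::comm_ring_1) \<Rightarrow> 'a list \<Rightarrow> 'r" where
  "cyclic_diff F xs = (\<Sum>i<length xs. (-1) ^ i * F (contract i xs))"

definition bar_diff :: "('a list \<Rightarrow> 'r::comm_ring_1) \<Rightarrow> 'a list \<Rightarrow> 'r" where
  "bar_diff F xs = (\<Sum>i<length xs - 1. (-1) ^ i * F (contract i xs))"

definition one_minus_t :: "('a list \<Rightarrow> 'r::comm_ring_1) \<Rightarrow> 'a list \<Rightarrow> 'r" where
  "one_minus_t F xs = F xs - (-1) ^ (length xs - 1) * F (rot xs)"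

definition norm_t :: "('a list \<Rightarrow> 'r::comm_ring_1) \<Rightarrow> 'a list \<Rightarrow> 'r" where
  "norm_t F xs = (\<Sum>j<length xs. (-1) ^ ((length xs - 1) * j) * F ((rot ^^ j) xs))"

definition insert_one :: "('a list \<Rightarrow> 'r::comm_ring_1) \<Rightarrow> 'a list \<Rightarrow> 'r" where
  "insert_one F xs = F (1 # xs)"

text \<open>Rotation shifts the contractions by one place: the zeroth one becomes the last one, which is the
  term by which \<open>b\<close> and \<open>b'\<close> differ, and the others are matched by \<open>b'\<close> after a rotation.\<close>

lemma bar_diff_one_minus_t:
  assumes "length xs = Suc (Suc n)"
  shows "bar_diff (one_minus_t F) xs = one_minus_t (cyclic_diff F) xs"
proof -
  have ne: "xs \<noteq> []" using assms by auto
  have "cyclic_diff F (rot xs) =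
      F (contract (Suc n) xs) - (\<Sum>i<Suc n. (-1) ^ i * F (rot (contract i xs)))"
    using assms ne
    by (simp add: cyclic_diff_def sum.lessThan_Suc_shift contract_0_rot contract_Suc_rot sum_negf
        del: sum.lessThan_Suc)
  moreover have "cyclic_diff F xs =
      (\<Sum>i<Suc n. (-1) ^ i * F (contract i xs)) + (-1) ^ Suc n * F (contract (Suc n) xs)"
    using assms by (simp add: cyclic_diff_def)
  moreover have "bar_diff (one_minus_t F) xs =
      (\<Sum>i<Suc n. (-1) ^ i * F (contract i xs))
      - (-1) ^ n * (\<Sum>i<Suc n. (-1) ^ i * F (rot (contract i xs)))"
    using assms
    by (simp add: bar_diff_def one_minus_t_def length_contract right_diff_distrib sum_subtractf
        sum_distrib_left mult.left_commute del: sum.lessThan_Suc)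
  ultimately show ?thesis
    using assms by (simp add: one_minus_t_def right_diff_distrib del: sum.lessThan_Suc)
qed

text \<open>The relation \<open>b's + sb' = 1\<close>: contracting a leading \<open>1\<close> with its successor removes it.\<close>

lemma bar_diff_insert_one:
  assumes "xs \<noteq> []"
  shows "bar_diff (insert_one G) xs = G xs - bar_diff G (1 # xs)"
proof -
  obtain n where n: "length xs = Suc n" using assms by (cases xs) auto
  have 1: "contract 0 (1 # xs) = xs" using assms by (cases xs) (auto simp: contract_def)
  have 2: "contract (Suc i) (1 # xs) = 1 # contract i xs" if "i < n" for i
    using that n by (simp add: contract_def)
  show ?thesis
    using n 1 2 by (simp add: bar_diff_def insert_one_def sum.lessThan_Suc_shift sum_negf
        del: sum.lessThan_Suc)
qed

lemma norm_t_one_minus_t: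
  assumes "xs \<noteq> []"
  shows "norm_t (one_minus_t F) xs = F xs - F (map \<rho> xs)"
proof -
  define e :: 'b where "e = (-1) ^ (length xs - 1)"
  define a where "a j = e ^ j * F ((rot ^^ j) xs)" for j
  have "norm_t (one_minus_t F) xs = (\<Sum>j<length xs. a j - a (Suc j))"
    using assms unfolding norm_t_def
    by (intro sum.cong) (simp_all add: a_def e_def one_minus_t_def power_mult right_diff_distrib mult.left_commute)
  also have "\<dots> = a 0 - a (length xs)"
    by (rule sum_lessThan_telescope')
  also have "e ^ length xs = 1"
  proof -
    \<comment> \<open>Two consecutive numbers have an even product, so the sign of a full turn is \<open>1\<close>.\<close>
    have "even ((length xs - 1) * length xs)" by (cases "length xs") auto
    then show ?thesis unfolding e_def power_mult[symmetric] by simp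
  qed
  then have "a 0 - a (length xs) = F xs - F (map \<rho> xs)"
    by (simp add: a_def rot_funpow_length)
  finally show ?thesis .
qed

text \<open>Both sides are sums over all ways to rotate and contract, with \<open>n + 2\<close> rotations and \<open>n + 1\<close> contractions on
  the left, and \<open>n + 1\<close> rotations and \<open>n + 2\<close> contractions on the right. Moving the contraction
  inside, \<open>contract_rot_funpow\<close> and \<open>contract_rot_funpow_wrap\<close> match the two index sets.\<close>

lemma norm_t_bar_diff:
  assumes len: "length xs = Suc (Suc n)"
  shows "norm_t (bar_diff g) xs = cyclic_diff (norm_t g) xs"
proof -
  have ne: "xs \<noteq> []" using len by auto
  define L where "L = (\<lambda>(j, i). (-1) ^ (Suc n * j) * ((-1) ^ i * g (contract i ((rot ^^ j) xs))))"
  define R where "R = (\<lambda>(p, q). (-1) ^ p * ((-1) ^ (n * q) * g ((rot ^^ q) (contract p xs))))"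
  have "norm_t (bar_diff g) xs = (\<Sum>j<Suc (Suc n). \<Sum>i<Suc n. L (j, i))"
    unfolding norm_t_def bar_diff_def L_def
    using len ne by (simp add: sum_distrib_left del: sum.lessThan_Suc mult_Suc)
  also have "\<dots> = sum L ({..<Suc (Suc n)} \<times> {..<Suc n})"
    by (simp only: sum.cartesian_product) (simp add: case_prod_unfold)
  also have "\<dots> = sum R ({..<Suc (Suc n)} \<times> {..<Suc n})"
  \<comment> \<open>Rotations before the contraction go with \<open>p + q \<le> n\<close>, those that carry it past the end with \<open>p + q > n\<close>.\<close>
  proof (rule sum.reindex_bij_witness[where
        j = "\<lambda>(j, i). if j \<le> i then (i - j, j) else (Suc (Suc n) + i - j, j - 1)" and
        i = "\<lambda>(p, q). if p + q \<le> n then (q, p + q) else (Suc q, p + q - Suc n)"], goal_cases)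
    case (5 a)
    obtain j i where a: "a = (j, i)" by force
    with 5 have ji: "j \<le> Suc n" "i \<le> n" by auto
    show ?case
    proof (cases "j \<le> i")
      case True
      then obtain d where d: "i = j + d" using le_Suc_ex by blast
      have "contract i ((rot ^^ j) xs) = (rot ^^ j) (contract (i - j) xs)"
        using True ji len by (intro contract_rot_funpow) auto
      then show ?thesis
        by (simp add: a L_def R_def d power_add algebra_simps flip: power_mult_distrib)
    next
      case False
      then obtain q where q: "j = i + Suc q"
        by (metis add_Suc_right less_imp_Suc_add linorder_not_less)
      then have "i + q \<le> n" using ji by simp
      then obtain r where r: "n = i + q + r" using le_Suc_ex by blast
      have c: "contract i ((rot ^^ j) xs) = (rot ^^ (i + q)) (contract (Suc n - q) xs)"
        unfolding q using ji q len by (intro contract_rot_funpow_wrap) auto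
      have p: "Suc (Suc n) + i - j = Suc n - q" "j - 1 = i + q" "Suc n - q = Suc (i + r)"
        using q r by auto
      have e: "even (Suc n * j + i + (Suc (i + r) + n * (i + q)))"
        by (auto simp: q r)
      have s: "(-1::'b) ^ (Suc n * j + i) = (-1) ^ (Suc (i + r) + n * (i + q))"
        using e unfolding minus_one_power_iff even_add by simp
      have "L a = (-1) ^ (Suc n * j + i) * g ((rot ^^ (i + q)) (contract (Suc (i + r)) xs))"
        by (simp add: a L_def c p(3) power_add mult.assoc del: mult_Suc)
      also have "\<dots> = R (Suc (i + r), i + q)"
        by (simp only: s R_def) (simp add: power_add mult.assoc)
      finally show ?thesis using False unfolding a prod.case p by simp
    qed
  qed (auto split: if_splits)
  also have "\<dots> = (\<Sum>p<Suc (Suc n). \<Sum>q<Suc n. R (p, q))"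
    by (simp only: sum.cartesian_product) (simp add: case_prod_unfold)
  also have "\<dots> = cyclic_diff (norm_t g) xs"
    unfolding norm_t_def cyclic_diff_def R_def
    using len ne by (simp add: sum_distrib_left length_contract del: sum.lessThan_Suc)
  finally show ?thesis .
qed

text \<open>The null-homotopy of \<open>1 - T\<close> on cocycles. The right-hand side is kept as \<open>Nb's(1 - t)F\<close>, because its form
  \<open>bNs(1 - t)F\<close> has a meaning only for words with at least two letters; on one-letter words, which
  belong to cochains of degree \<open>0\<close>, the sum \<open>b'\<close> is empty.\<close>

lemma twist_homotopy:
  assumes "\<And>ys. length ys = Suc (length xs) \<Longrightarrow> cyclic_diff F ys = 0" "xs \<noteq> []"
  shows "F xs - F (map \<rho> xs) = norm_t (bar_diff (insert_one (one_minus_t F))) xs"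
proof -
  have "bar_diff (insert_one (one_minus_t F)) ys = one_minus_t F ys"
    if "length ys = length xs" for ys
  proof -
    have "ys \<noteq> []" using that assms(2) by auto
    moreover have "bar_diff (one_minus_t F) (1 # ys) = 0"
    proof -
      obtain n where "length xs = Suc n" using assms(2) by (cases xs) auto
      with that have n: "length (1 # ys) = Suc (Suc n)" by simp
      have "length (rot (1 # ys)) = Suc (length xs)" by (simp add: that)
      then show ?thesis
        using assms(1) that unfolding bar_diff_one_minus_t[OF n] one_minus_t_def by simp
    qed
    ultimately show ?thesis by (simp add: bar_diff_insert_one)
  qed
  then have "norm_t (bar_diff (insert_one (one_minus_t F))) xs = norm_t (one_minus_t F) xs"
    using assms(2) unfolding norm_t_def by simp
  then show ?thesis using assms(2) by (simp add: norm_t_one_minus_t)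
qed

end

section \<open>Multilinear maps and the cochain complex\<close>

definition multilinear ::
  "('k::field \<Rightarrow> 'a::ab_group_add \<Rightarrow> 'a) \<Rightarrow> ('k \<Rightarrow> 'b::ab_group_add \<Rightarrow> 'b) \<Rightarrow> nat
    \<Rightarrow> ('a list \<Rightarrow> 'b) \<Rightarrow> bool" where
  "multilinear s t n F \<longleftrightarrow>
     (\<forall>xs i. length xs = n \<and> i < n \<longrightarrow> Vector_Spaces.linear s t (\<lambda>x. F (xs[i := x])))"

lemma multilinearI:
  assumes "\<And>xs i. length xs = n \<Longrightarrow> i < n \<Longrightarrow> Vector_Spaces.linear s t (\<lambda>x. F (xs[i := x]))"
  shows "multilinear s t n F"
  using assms by (simp add: multilinear_def)

lemma multilinearD:
  "multilinear s t n F \<Longrightarrow> length xs = n \<Longrightarrow> i < n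
    \<Longrightarrow> Vector_Spaces.linear s t (\<lambda>x. F (xs[i := x]))"
  by (simp add: multilinear_def)

lemma multilinear_compose:
  assumes "multilinear s t n F" "Vector_Spaces.linear t t g"
  shows "multilinear s t n (\<lambda>xs. g (F xs))"
proof (rule multilinearI)
  fix xs :: "'b list" and i
  assume "length xs = n" "i < n"
  from Vector_Spaces.linear_compose[OF multilinearD[OF assms(1) this] assms(2)]
  show "Vector_Spaces.linear s t (\<lambda>x. g (F (xs[i := x])))" by (simp add: comp_def)
qed

lemma multilinear_map:
  assumes F: "multilinear s t n F" and g: "Vector_Spaces.linear s s g"
  shows "multilinear s t n (\<lambda>xs. F (map g xs))"
proof (rule multilinearI)
  fix xs :: "'b list" and i
  assume "length xs = n" "i < n"
  then have "Vector_Spaces.linear s t (\<lambda>x. F ((map g xs)[i := x]))"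
    using F by (simp add: multilinear_def)
  from Vector_Spaces.linear_compose[OF g this]
  show "Vector_Spaces.linear s t (\<lambda>x. F (map g (xs[i := x])))"
    by (simp add: comp_def map_update)
qed

lemma sum_fun_apply: "(\<Sum>a\<in>A. f a) x = (\<Sum>a\<in>A. f a x)"
  by (induction A rule: infinite_finite_induct) auto

lemma cochains_iff:
  "f \<in> cochains scale n \<longleftrightarrow>
     (\<forall>xs. length xs \<noteq> n \<longrightarrow> f xs = 0) \<and> multilinear scale scale n f"
  by (simp add: cochains_def multilinear_def)

context finite_dimensional_algebra
begin

sublocale endo: vector_space_pair scale scale ..

sublocale cochain: vector_space "\<lambda>c (f :: 'a list \<Rightarrow> 'a) xs. scale c (f xs)"
  by unfold_locales (auto simp: scale_right_distrib scale_left_distrib)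

sublocale cochain_pair: vector_space_pair "\<lambda>c (f :: 'a list \<Rightarrow> 'a) xs. scale c (f xs)"
  "\<lambda>c (f :: 'a list \<Rightarrow> 'a) xs. scale c (f xs)" ..

lemma subspace_cochains: "cochain.subspace (cochains scale n)"
  unfolding cochain.subspace_def
  by (simp add: cochains_def endo.linear_zero endo.linear_compose_add
      endo.linear_compose_scale_right)

lemma differential_linear:
  "Vector_Spaces.linear (\<lambda>c (f :: 'a list \<Rightarrow> 'a) xs. scale c (f xs)) (\<lambda>c f xs. scale c (f xs))
     (hochschild_differential scale n)"
  unfolding Vector_Spaces.linear_iff
proof (intro conjI allI ext)
  fix f g :: "'a list \<Rightarrow> 'a" and c xs
  show "hochschild_differential scale n (f + g) xs =
      (hochschild_differential scale n f + hochschild_differential scale n g) xs"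
    by (simp add: hochschild_differential_def distrib_left distrib_right scale_right_distrib
        sum.distrib del: power_Suc)
  show "hochschild_differential scale n (\<lambda>xs. scale c (f xs)) xs =
      scale c (hochschild_differential scale n f xs)"
    by (simp add: hochschild_differential_def scale_right_distrib scale_sum_right
        scale_mult_left scale_mult_right mult.commute[of c] del: power_Suc)
qed (rule cochain.vector_space_axioms)+

lemmas differential_diff = cochain_pair.linear_diff[OF differential_linear]
  and differential_sum = cochain_pair.linear_sum[OF differential_linear]
  and differential_scale = cochain_pair.linear_scale[OF differential_linear]

lemma subspace_coboundaries:
  assumes "\<And>k. cochain.subspace (C k)"
  shows "cochain.subspace (coboundaries scale C n)"
proof (cases n)
  case (Suc k)
  interpret d: Vector_Spaces.linear "\<lambda>c (f :: 'a list \<Rightarrow> 'a) xs. scale c (f xs)"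
    "\<lambda>c (f :: 'a list \<Rightarrow> 'a) xs. scale c (f xs)" "hochschild_differential scale k"
    by (rule differential_linear)
  show ?thesis using d.subspace_image[OF assms] Suc by simp
qed simp

text \<open>The inclusion sends the coset of \<open>f\<close> to the coset of \<open>f\<close>, so it is compatible with the operations;
  the last two hypotheses are its injectivity and surjectivity.\<close>

lemma inclusion_cohomology_iso:
  assumes C: "\<And>k. cochain.subspace (C k)" and C': "\<And>k. cochain.subspace (C' k)"
    and sub: "\<And>k. C k \<subseteq> C' k"
    and inj: "\<And>f. f \<in> cocycles scale C n \<Longrightarrow> f \<in> coboundaries scale C' n
      \<Longrightarrow> f \<in> coboundaries scale C n"
    and surj: "\<And>f. f \<in> cocycles scale C' n
      \<Longrightarrow> \<exists>g \<in> cocycles scale C n. f - g \<in> coboundaries scale C' n"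
  shows "cohomology_iso scale C C' n (inclusion_map scale C' n)"
proof -
  let ?B = "coboundaries scale C n" and ?B' = "coboundaries scale C' n"
  let ?F = "inclusion_map scale C' n"
  have B: "cochain.subspace ?B" and B': "cochain.subspace ?B'"
    using C C' by (auto intro: subspace_coboundaries)
  have BB': "?B \<subseteq> ?B'" using sub by (cases n) auto
  have absorb: "V + W = W" if "cochain.subspace V" "cochain.subspace W" "V \<subseteq> W" for V W
  proof
    show "V + W \<subseteq> W"
      using that(3) cochain.subspace_add[OF that(2)] by (auto simp: set_plus_def)
    show "W \<subseteq> V + W"
      using cochain.subspace_0[OF that(1)] by (rule set_zero_plus2)
  qed
  have coset_eq: "f +o W = g +o W \<longleftrightarrow> f - g \<in> W" if W: "cochain.subspace W" for f g W
  proof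
    assume "f +o W = g +o W"
    moreover have "f \<in> f +o W"
      using cochain.subspace_0[OF W] by (auto simp: elt_set_plus_def)
    ultimately show "f - g \<in> W" by (auto simp: elt_set_plus_def)
  next
    assume fg: "f - g \<in> W"
    have "f +o W = (g + (f - g)) +o W" by simp
    also have "\<dots> = g +o ((f - g) +o W)" by (simp only: set_plus_rearrange2)
    also have "(f - g) +o W = W"
    proof (intro equalityI subsetI)
      fix x assume "x \<in> W"
      then have "x - (f - g) \<in> W" using fg cochain.subspace_diff[OF W] by blast
      then show "x \<in> (f - g) +o W" by (force simp: elt_set_plus_def)
    qed (use fg cochain.subspace_add[OF W] in \<open>auto simp: elt_set_plus_def\<close>)
    finally show "f +o W = g +o W" .
  qed
  have F: "?F (f +o ?B) = f +o ?B'" for f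
    by (simp add: inclusion_map_def set_plus_rearrange3 absorb[OF B B' BB'])
  have coset_add: "(f +o W) + (g +o W) = (f + g) +o W" if "cochain.subspace W" for f g W
    by (simp add: set_plus_rearrange absorb that)
  have coset_scale: "class_scale scale D n c (f +o coboundaries scale D n) =
      (\<lambda>xs. scale c (f xs)) +o coboundaries scale D n" (is "_ = ?cf +o ?W")
    if D: "cochain.subspace (coboundaries scale D n)" for D c f
  proof -
    have "(\<lambda>h xs. scale c (h xs)) ` (f +o ?W) = ?cf +o (\<lambda>h xs. scale c (h xs)) ` ?W"
    proof -
      have translate: "g +o V = (\<lambda>h. g + h) ` V" for g :: "'a list \<Rightarrow> 'a" and V
        by (auto simp: elt_set_plus_def)
      show ?thesis
        unfolding translate image_image by (simp add: plus_fun_def scale_right_distrib)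
    qed
    moreover have "(\<lambda>h xs. scale c (h xs)) ` ?W + ?W = ?W"
    proof
      show "(\<lambda>h xs. scale c (h xs)) ` ?W + ?W \<subseteq> ?W"
        using cochain.subspace_add[OF D] cochain.subspace_scale[OF D] by (auto simp: set_plus_def)
      have "0 \<in> (\<lambda>h xs. scale c (h xs)) ` ?W"
        using cochain.subspace_0[OF D] by (auto simp: image_iff fun_eq_iff intro!: bexI[of _ 0])
      then show "?W \<subseteq> (\<lambda>h xs. scale c (h xs)) ` ?W + ?W" by (rule set_zero_plus2)
    qed
    ultimately show ?thesis by (simp add: class_scale_def set_plus_rearrange3)
  qed
  have cocycles_sub: "cocycles scale C n \<subseteq> cocycles scale C' n"
    using sub by (auto simp: cocycles_def)
  have cocycles_diff: "f - g \<in> cocycles scale C n"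
    if "f \<in> cocycles scale C n" "g \<in> cocycles scale C n" for f g
    using that by (simp add: cocycles_def differential_diff cochain.subspace_diff[OF C])
  have "bij_betw ?F (cohomology scale C n) (cohomology scale C' n)"
    unfolding bij_betw_def
  proof
    show "inj_on ?F (cohomology scale C n)"
      unfolding cohomology_def
      by (auto simp: inj_on_def F coset_eq[OF B] coset_eq[OF B'] intro: inj cocycles_diff)
    have "f +o ?B' \<in> (\<lambda>g. g +o ?B') ` cocycles scale C n" if "f \<in> cocycles scale C' n" for f
      using surj[OF that] by (auto simp: coset_eq[OF B'] image_iff)
    then show "?F ` cohomology scale C n = cohomology scale C' n"
      using cocycles_sub by (auto simp: cohomology_def image_image F)
  qed
  then show ?thesis
    unfolding cohomology_iso_def
    by (auto simp: cohomology_def F coset_add[OF B] coset_add[OF B'] coset_scale[OF B]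
        coset_scale[OF B'])
qed

end

section \<open>The action of an automorphism on cochains\<close>

locale algebra_with_automorphism = finite_dimensional_algebra scale
  for scale :: "'k::field \<Rightarrow> 'a::{ring, monoid_mult} \<Rightarrow> 'a" +
  fixes \<rho> :: "'a \<Rightarrow> 'a"
  assumes automorphism: "algebra_automorphism scale \<rho>"
begin

sublocale multiplicative_map \<rho>
  using automorphism by unfold_locales (auto simp: algebra_automorphism_def)

lemma rho_linear: "Vector_Spaces.linear scale scale \<rho>"
  and rho_bij: "bij \<rho>"
  using automorphism by (auto simp: algebra_automorphism_def)

lemma rho_inv [simp]: "\<rho> (inv \<rho> x) = x"
  and inv_rho [simp]: "inv \<rho> (\<rho> x) = x"
  using rho_bij by (simp_all add: bij_is_surj surj_f_inv_f bij_is_inj)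

lemma inv_linear: "Vector_Spaces.linear scale scale (inv \<rho>)"
proof -
  have "inv \<rho> (x + y) = inv \<rho> x + inv \<rho> y" "inv \<rho> (scale c x) = scale c (inv \<rho> x)" for x y c
    by (metis endo.linear_add[OF rho_linear] inv_rho rho_inv)
      (metis endo.linear_scale[OF rho_linear] inv_rho rho_inv)
  then show ?thesis by (simp add: Vector_Spaces.linear_iff vector_space_axioms)
qed

lemma inv_mult: "inv \<rho> (x * y) = inv \<rho> x * inv \<rho> y"
  by (metis map_mult inv_rho rho_inv)

definition twist :: "('a list \<Rightarrow> 'a) \<Rightarrow> 'a list \<Rightarrow> 'a" where
  "twist f = (\<lambda>xs. inv \<rho> (f (map \<rho> xs)))"

lemma twist_fixed_iff: "twist f = f \<longleftrightarrow> (\<forall>xs. \<rho> (f xs) = f (map \<rho> xs))"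
  unfolding twist_def fun_eq_iff by (metis inv_rho rho_inv)

lemma twist_cochain:
  assumes "f \<in> cochains scale n"
  shows "twist f \<in> cochains scale n"
proof -
  have "multilinear scale scale n f" using assms by (simp add: cochains_iff)
  from multilinear_compose[OF multilinear_map[OF this rho_linear] inv_linear]
  show ?thesis
    using assms endo.linear_0[OF inv_linear] by (simp add: cochains_iff twist_def)
qed

lemma twist_linear:
  "Vector_Spaces.linear (\<lambda>c (f :: 'a list \<Rightarrow> 'a) xs. scale c (f xs)) (\<lambda>c f xs. scale c (f xs)) twist"
  by (simp add: Vector_Spaces.linear_iff cochain.vector_space_axioms twist_def fun_eq_iff
      endo.linear_add[OF inv_linear] endo.linear_scale[OF inv_linear])

text \<open>Conjugation by an algebra automorphism preserves the structure that defines the Hochschild complex.\<close>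

lemma differential_twist:
  "hochschild_differential scale n (twist f) = twist (hochschild_differential scale n f)"
proof
  fix xs :: "'a list"
  show "hochschild_differential scale n (twist f) xs = twist (hochschild_differential scale n f) xs"
  proof (cases "length xs = Suc n")
    case True
    then have "xs \<noteq> []" by auto
    with True show ?thesis
      by (simp add: hochschild_differential_def twist_def endo.linear_add[OF inv_linear]
          endo.linear_scale[OF inv_linear] endo.linear_sum[OF inv_linear] inv_mult hd_map last_map
          map_tl map_butlast take_map drop_map map_mult del: power_Suc)
  next
    case False
    then show ?thesis
      by (simp add: hochschild_differential_def twist_def endo.linear_0[OF inv_linear])
  qed
qed

end

section \<open>The Nakayama automorphism acts trivially on cohomology\<close>

locale frobenius_algebra_with_nakayama = finite_dimensional_algebra scale
  for scale :: "'k::field \<Rightarrow> 'a::{ring, monoid_mult} \<Rightarrow> 'a" +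
  fixes \<phi> :: "'a \<Rightarrow> 'k" and \<rho> :: "'a \<Rightarrow> 'a"
  assumes frobenius: "frobenius_homomorphism scale \<phi>"
    and nakayama: "nakayama_automorphism scale \<phi> \<rho>"
begin

sublocale algebra_with_automorphism scale \<rho>
  using nakayama by unfold_locales (simp add: nakayama_automorphism_def)

sublocale form: vector_space_pair scale "(*)"
  by unfold_locales (auto simp: algebra_simps)

lemma phi_linear: "Vector_Spaces.linear scale (*) \<phi>"
  using frobenius by (simp add: frobenius_homomorphism_def dual_def)

lemmas phi_add = form.linear_add[OF phi_linear]
  and phi_diff = form.linear_diff[OF phi_linear]
  and phi_sum = form.linear_sum[OF phi_linear]
  and phi_scale = form.linear_scale[OF phi_linear]

text \<open>The defining property of the Nakayama automorphism as a twisted trace property of \<open>\<phi>\<close>.\<close>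

lemma phi_rotate: "\<phi> (\<rho> x * a) = \<phi> (a * x)"
proof -
  have "left_act x \<phi> = right_act \<phi> (\<rho> x)"
    using nakayama by (simp add: nakayama_automorphism_def)
  from fun_cong[OF this, of a] show ?thesis by (simp add: left_act_def right_act_def)
qed

lemma phi_rho: "\<phi> (\<rho> x) = \<phi> x"
  using phi_rotate[of x 1] by simp

lemma left_act_bij: "bij_betw (\<lambda>x. left_act x \<phi>) UNIV (dual scale)"
  using frobenius by (simp add: frobenius_homomorphism_def left_module_iso_dual_def)

lemma phi_nondegenerate:
  assumes "\<And>a. \<phi> (a * x) = \<phi> (a * y)"
  shows "x = y"
proof -
  have "left_act x \<phi> = left_act y \<phi>" using assms by (simp add: left_act_def)
  with left_act_bij show ?thesis by (auto simp: bij_betw_def dest: injD)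
qed

lemma phi_represents:
  assumes "Vector_Spaces.linear scale (*) \<psi>"
  obtains y where "\<And>a. \<psi> a = \<phi> (a * y)"
proof -
  have "\<psi> \<in> range (\<lambda>x. left_act x \<phi>)"
    using left_act_bij assms by (simp add: bij_betw_def dual_def)
  then show ?thesis using that by (auto simp: left_act_def)
qed

text \<open>Under the correspondence between cochains and forms, the Hochschild differential is the cyclic
  differential \<open>b\<close>: the outer multiplications are contractions with the new letter \<open>a\<close>, where the right
  multiplication is carried around by \<open>phi_rotate\<close>.\<close>

lemma cyclic_diff_form:
  assumes F: "\<And>a as. length as = n \<Longrightarrow> F (a # as) = \<phi> (a * f as)"
    and len: "length xs = Suc n"
  shows "cyclic_diff F (a # xs) = \<phi> (a * hochschild_differential scale n f xs)"
proof -
  have ne: "xs \<noteq> []" using len by auto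
  have first: "F (contract 0 (a # xs)) = \<phi> (a * (hd xs * f (tl xs)))"
    using len ne F by (cases xs) (simp_all add: contract_def mult.assoc)
  have middle: "F (contract (Suc i) (a # xs)) =
      \<phi> (a * f (take i xs @ (xs ! i * xs ! Suc i) # drop (Suc (Suc i)) xs))" if "i < n" for i
    using that len F by (simp add: contract_def)
  have "F (contract (Suc n) (a # xs)) = \<phi> ((\<rho> (last xs) * a) * f (butlast xs))"
    using len ne F by (simp add: contract_def)
  also have "\<dots> = \<phi> (a * (f (butlast xs) * last xs))"
    by (simp add: mult.assoc phi_rotate)
  finally have last: "F (contract (Suc n) (a # xs)) = \<phi> (a * (f (butlast xs) * last xs))" .
  have "cyclic_diff F (a # xs) = F (contract 0 (a # xs))
      + (\<Sum>i<n. (-1) ^ Suc i * F (contract (Suc i) (a # xs)))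
      + (-1) ^ Suc n * F (contract (Suc n) (a # xs))"
    using len
    by (simp add: cyclic_diff_def sum.lessThan_Suc_shift[of _ "Suc n"] del: sum.lessThan_Suc)
      (simp add: add.assoc)
  also have "\<dots> = \<phi> (a * hochschild_differential scale n f xs)"
    using len
    by (simp add: first middle last hochschild_differential_def distrib_left sum_distrib_left
        phi_add phi_sum phi_scale scale_mult_right del: power_Suc)
  finally show ?thesis .
qed

lemma multilinear_form:
  assumes "multilinear scale scale n f"
  shows "multilinear scale (*) (Suc n) (\<lambda>xs. \<phi> (hd xs * f (tl xs)))"
proof (rule multilinearI)
  fix xs :: "'a list" and i
  assume len: "length xs = Suc n" and i: "i < Suc n"
  then obtain a as where xs: "xs = a # as" "length as = n" by (cases xs) auto
  show "Vector_Spaces.linear scale (*) (\<lambda>x. \<phi> (hd (xs[i := x]) * f (tl (xs[i := x]))))"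
  proof (cases i)
    case 0
    then show ?thesis
      by (simp add: xs vector_space_axioms form.vs2.vector_space_axioms Vector_Spaces.linear_iff
          distrib_right phi_add scale_mult_left phi_scale)
  next
    case (Suc j)
    then have "Vector_Spaces.linear scale scale (\<lambda>x. f (as[j := x]))"
      using assms i xs by (simp add: multilinear_def)
    then show ?thesis
      by (simp add: xs Suc Vector_Spaces.linear_iff distrib_left phi_add scale_mult_right phi_scale
          form.vs2.vector_space_axioms)
  qed
qed

text \<open>For fixed remaining arguments a form is linear in its first one, hence represented by a unique
  element of \<open>A\<close>; uniqueness makes the representing element linear in the other arguments.\<close>

lemma cochain_of_form:
  assumes g: "multilinear scale (*) (Suc n) g"
  obtains h where "h \<in> cochains scale n"
    and "\<And>a as. length as = n \<Longrightarrow> g (a # as) = \<phi> (a * h as)"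
proof -
  have "\<exists>y. \<forall>a. g (a # as) = \<phi> (a * y)" if "length as = n" for as
  proof -
    have "Vector_Spaces.linear scale (*) (\<lambda>a. g (a # as))"
      using multilinearD[OF g, of "0 # as" 0] that by simp
    then show ?thesis by (metis phi_represents)
  qed
  then obtain y where y: "\<And>a as. length as = n \<Longrightarrow> g (a # as) = \<phi> (a * y as)"
    by metis
  define h where "h as = (if length as = n then y as else 0)" for as
  have "multilinear scale scale n h"
  proof (rule multilinearI)
    fix as :: "'a list" and i
    assume as: "length as = n" and i: "i < n"
    have upd: "g (a # as[i := x]) = \<phi> (a * h (as[i := x]))" for a x
      using as y by (simp add: h_def)
    have lin: "Vector_Spaces.linear scale (*) (\<lambda>x. g (a # as[i := x]))" for a
      using multilinearD[OF g, of "a # as" "Suc i"] as i by simp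
    show "Vector_Spaces.linear scale scale (\<lambda>x. h (as[i := x]))"
      unfolding Vector_Spaces.linear_iff
    proof (intro conjI allI phi_nondegenerate)
      fix a x z c
      show "\<phi> (a * h (as[i := x + z])) = \<phi> (a * (h (as[i := x]) + h (as[i := z])))"
        using form.linear_add[OF lin, of a x z] by (simp add: upd distrib_left phi_add)
      show "\<phi> (a * h (as[i := scale c x])) = \<phi> (a * scale c (h (as[i := x])))"
        using form.linear_scale[OF lin, of a c x] by (simp add: upd scale_mult_right phi_scale)
    qed (rule vector_space_axioms)+
  qed
  then have "h \<in> cochains scale n" by (simp add: cochains_iff h_def)
  then show ?thesis using that y by (simp add: h_def)
qed

lemma multilinear_rot:
  assumes F: "multilinear scale (*) n F"
  shows "multilinear scale (*) n (\<lambda>xs. F (rot xs))"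
proof (rule multilinearI)
  fix xs :: "'a list" and i
  assume len: "length xs = n" and i: "i < n"
  then obtain ys z where xs: "xs = ys @ [z]" by (metis length_0_conv not_less_zero rev_exhaust)
  have len': "length (rot xs) = n" using len i by (auto simp: rot_def)
  show "Vector_Spaces.linear scale (*) (\<lambda>x. F (rot (xs[i := x])))"
  proof (cases "i < length ys")
    case True
    then have "rot (xs[i := x]) = (rot xs)[Suc i := x]" for x
      by (simp add: xs rot_def list_update_append butlast_append)
    then show ?thesis using multilinearD[OF F len', of "Suc i"] True len xs by simp
  next
    case False
    then have "i = length ys" using i len xs by simp
    then have "rot (xs[i := x]) = (rot xs)[0 := \<rho> x]" for x
      by (simp add: xs rot_def)
    moreover have "Vector_Spaces.linear scale (*) (\<lambda>x. F ((rot xs)[0 := \<rho> x]))"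
      using Vector_Spaces.linear_compose[OF rho_linear multilinearD[OF F len', of 0]] i
      by (simp add: comp_def)
    ultimately show ?thesis by simp
  qed
qed

lemma multilinear_rot_funpow:
  assumes "multilinear scale (*) n F"
  shows "multilinear scale (*) n (\<lambda>xs. F ((rot ^^ j) xs))"
proof (induction j)
  case (Suc j)
  from multilinear_rot[OF this] show ?case by (simp add: funpow_swap1)
qed (use assms in simp)

lemma multilinear_one_minus_t:
  assumes "multilinear scale (*) n F"
  shows "multilinear scale (*) n (one_minus_t F)"
  using assms multilinear_rot[OF assms] unfolding multilinear_def one_minus_t_def
  by (simp add: form.linear_compose_sub form.linear_compose_scale_right)

lemma multilinear_norm_t:
  assumes "multilinear scale (*) n F"
  shows "multilinear scale (*) n (norm_t F)"
  using multilinear_rot_funpow[OF assms] unfolding multilinear_def norm_t_def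
  by (simp add: form.linear_compose_sum form.linear_compose_scale_right)

lemma multilinear_insert_one:
  assumes "multilinear scale (*) (Suc n) F"
  shows "multilinear scale (*) n (insert_one F)"
proof (rule multilinearI)
  fix xs :: "'a list" and i
  assume "length xs = n" "i < n"
  then show "Vector_Spaces.linear scale (*) (\<lambda>x. insert_one F (xs[i := x]))"
    using multilinearD[OF assms, of "1 # xs" "Suc i"] by (simp add: insert_one_def)
qed

text \<open>The form of \<open>twist f\<close> is \<open>TF\<close> because \<open>\<phi>\<close> is \<open>\<rho>\<close>-invariant, so \<open>twist_homotopy\<close>
  applies. In degree \<open>0\<close> it gives equality, in positive degree it gives the coboundary of the cochain
  that represents \<open>Ns(1 - t)F\<close>.\<close>

lemma twist_cocycle_cohomologous:
  assumes f: "f \<in> cocycles scale (cochains scale) n"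
  shows "f - twist f \<in> coboundaries scale (cochains scale) n"
proof -
  define F where "F xs = \<phi> (hd xs * f (tl xs))" for xs
  define g where "g = norm_t (insert_one (one_minus_t F))"
  have fc: "f \<in> cochains scale n" and df: "hochschild_differential scale n f = 0"
    using f by (auto simp: cocycles_def)
  have F: "multilinear scale (*) (Suc n) F"
    using fc multilinear_form unfolding F_def by (simp add: cochains_iff)
  have cycF: "cyclic_diff F ys = 0" if "length ys = Suc (Suc n)" for ys
  proof -
    from that obtain a xs where ys: "ys = a # xs" "length xs = Suc n" by (cases ys) auto
    show ?thesis
      using cyclic_diff_form[of n F f xs a] ys df F_def form.linear_0[OF phi_linear] by simp
  qed
  have diff: "\<phi> (a * ((f - twist f) as)) =
      norm_t (bar_diff (insert_one (one_minus_t F))) (a # as)" if "length as = n" for a as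
  proof -
    \<comment> \<open>The form of \<open>twist f\<close> is \<open>F\<close> with \<open>\<rho>\<close> applied to all arguments.\<close>
    have "\<phi> (\<rho> a * f (map \<rho> as)) = \<phi> (\<rho> (a * inv \<rho> (f (map \<rho> as))))"
      by (simp add: map_mult)
    then have "\<phi> (\<rho> a * f (map \<rho> as)) = \<phi> (a * inv \<rho> (f (map \<rho> as)))"
      by (simp add: phi_rho)
    moreover have "F (a # as) - F (map \<rho> (a # as)) =
        norm_t (bar_diff (insert_one (one_minus_t F))) (a # as)"
      by (rule twist_homotopy) (use that cycF in auto)
    ultimately show ?thesis
      by (simp add: F_def right_diff_distrib phi_diff twist_def)
  qed
  have off: "(f - twist f) as = 0" if "length as \<noteq> n" for as
    using that fc twist_cochain[OF fc] by (simp add: cochains_iff)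
  show ?thesis
  proof (cases n)
    case 0
    have "(f - twist f) [] = 0"
    proof (rule phi_nondegenerate)
      fix a
      show "\<phi> (a * ((f - twist f) [])) = \<phi> (a * 0)"
        using diff[of "[]" a] 0 form.linear_0[OF phi_linear]
        by (simp add: norm_t_def bar_diff_def)
    qed
    then have "f - twist f = 0"
      using off 0 unfolding fun_eq_iff by (metis length_0_conv zero_fun_apply)
    then show ?thesis using 0 by simp
  next
    case (Suc k)
    have "multilinear scale (*) (Suc k) g"
      using F Suc unfolding g_def
      by (simp add: multilinear_norm_t multilinear_insert_one multilinear_one_minus_t)
    then obtain h where h: "h \<in> cochains scale k"
      and gh: "\<And>a as. length as = k \<Longrightarrow> g (a # as) = \<phi> (a * h as)"
      using cochain_of_form by metis
    have "(f - twist f) as = hochschild_differential scale k h as" for as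
    proof (cases "length as = n")
      case True
      show ?thesis
      proof (rule phi_nondegenerate)
        fix a
        have "\<phi> (a * ((f - twist f) as)) = cyclic_diff g (a # as)"
          using diff[OF True] norm_t_bar_diff[of "a # as" k] True Suc by (simp add: g_def)
        also have "\<dots> = \<phi> (a * hochschild_differential scale k h as)"
          using cyclic_diff_form[OF gh] True Suc by simp
        finally show "\<phi> (a * ((f - twist f) as)) =
            \<phi> (a * hochschild_differential scale k h as)" .
      qed
    next
      case False
      have "hochschild_differential scale k h as = 0"
        using False Suc by (simp add: hochschild_differential_def)
      with off[OF False] show ?thesis by metis
    qed
    then have "f - twist f = hochschild_differential scale k h" by auto
    then show ?thesis using h Suc by auto
  qed
qed

end

section \<open>The grading by eigenspaces\<close>

lemma primitive_root_power_eq_iff: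
  assumes w: "primitive_root_of_unity m w"
  shows "w ^ a = w ^ b \<longleftrightarrow> [a = b] (mod m)"
proof -
  have m: "0 < m" and wm: "w ^ m = 1"
    and min: "\<And>r. 0 < r \<Longrightarrow> r < m \<Longrightarrow> w ^ r \<noteq> 1"
    using w by (auto simp: primitive_root_of_unity_def Suc_le_eq)
  have w0: "w \<noteq> 0" using wm m by (auto simp: power_0_left)
  have red: "w ^ c = w ^ (c mod m)" for c
  proof -
    have "w ^ c = (w ^ m) ^ (c div m) * w ^ (c mod m)"
      by (simp flip: power_mult power_add)
    then show ?thesis by (simp add: wm)
  qed
  have le: "c = d" if "w ^ c = w ^ d" "c \<le> d" "d < m" for c d
  proof -
    have "w ^ d = w ^ c * w ^ (d - c)" using that(2) by (simp flip: power_add)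
    then have "w ^ (d - c) = 1" using that w0 by simp
    then show ?thesis using min[of "d - c"] that by (cases "c = d") auto
  qed
  have "w ^ a = w ^ b \<longleftrightarrow> w ^ (a mod m) = w ^ (b mod m)" using red by metis
  also have "\<dots> \<longleftrightarrow> a mod m = b mod m"
    using le[of "a mod m" "b mod m"] le[of "b mod m" "a mod m"] m
    by (metis mod_less_divisor nat_le_linear)
  finally show ?thesis by (simp add: cong_def)
qed

text \<open>The polynomial \<open>1 + x + \<dots> + x\<^sup>m\<^sup>-\<^sup>1\<close> has the \<open>m - 1\<close> roots \<open>w, \<dots>, w\<^sup>m\<^sup>-\<^sup>1\<close>. Its value
  at \<open>1\<close> is \<open>m\<close>, so if \<open>m\<close> vanished in the field it would have more roots than its degree permits.\<close>

lemma primitive_root_of_nat_neq_0: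
  fixes w :: "'k::field"
  assumes w: "primitive_root_of_unity m w"
  shows "of_nat m \<noteq> (0 :: 'k)"
proof
  assume m0: "of_nat m = (0 :: 'k)"
  have m: "0 < m" and wm: "w ^ m = 1"
    using w by (auto simp: primitive_root_of_unity_def)
  define p :: "'k poly" where "p = (\<Sum>j<m. monom 1 j)"
  have poly: "poly p x = (\<Sum>j<m. x ^ j)" for x
    by (simp add: p_def poly_sum poly_monom)
  have coeff: "coeff p i = (if i < m then 1 else 0)" for i
    by (simp add: p_def coeff_sum)
  then have "p \<noteq> 0" using m by (metis coeff_0 zero_neq_one)
  have "degree p \<le> m - 1" by (rule degree_le) (auto simp: coeff)
  have "(\<lambda>i. w ^ i) ` {..<m} \<subseteq> {x. poly p x = 0}"
  proof safe
    fix i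
    have "(w ^ i) ^ m = 1" by (metis power_commutes power_mult power_one wm mult.commute)
    then show "poly p (w ^ i) = 0"
      using m0 by (cases "w ^ i = 1") (simp_all add: poly geometric_sum)
  qed
  moreover have "inj_on (\<lambda>i. w ^ i) {..<m}"
    by (auto simp: inj_on_def primitive_root_power_eq_iff[OF w] cong_def)
  ultimately have "m \<le> card {x. poly p x = 0}"
    using \<open>p \<noteq> 0\<close> by (metis card_image card_lessThan card_mono poly_roots_finite)
  also have "\<dots> \<le> degree p" using \<open>p \<noteq> 0\<close> by (rule card_poly_roots_bound)
  finally show False using \<open>degree p \<le> m - 1\<close> m by simp
qed

locale diagonalizable_automorphism = algebra_with_automorphism scale \<rho>
  for scale :: "'k::field \<Rightarrow> 'a::{ring, monoid_mult} \<Rightarrow> 'a" and \<rho> :: "'a \<Rightarrow> 'a" +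
  fixes m :: nat and w :: 'k
  assumes rho_period: "\<rho> ^^ m = id"
    and primitive: "primitive_root_of_unity m w"
begin

lemma m_pos: "0 < m" and w_m: "w ^ m = 1" and w_nonzero: "w \<noteq> 0"
  using primitive by (auto simp: primitive_root_of_unity_def power_0_left)

lemmas w_power_eq_iff = primitive_root_power_eq_iff[OF primitive]
  and of_nat_m_neq_0 = primitive_root_of_nat_neq_0[OF primitive]

lemma rho_funpow_linear: "Vector_Spaces.linear scale scale (\<rho> ^^ j)"
proof (induction j)
  case 0
  then show ?case by (simp add: Vector_Spaces.linear_iff vector_space_axioms)
next
  case (Suc j)
  then show ?case using Vector_Spaces.linear_compose[OF Suc rho_linear] by (simp add: comp_def)
qed

lemmas rho_scale = endo.linear_scale[OF rho_linear]

text \<open>The projection to the eigenspace of \<open>w\<^sup>u\<close>, by discrete Fourier inversion on the cyclic group generated by \<open>\<rho>\<close>.\<close>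

definition component :: "nat \<Rightarrow> 'a \<Rightarrow> 'a" where
  "component u y = scale (1 / of_nat m) (\<Sum>j<m. scale ((inverse w ^ u) ^ j) ((\<rho> ^^ j) y))"

lemma component_linear: "Vector_Spaces.linear scale scale (component u)"
  unfolding component_def[abs_def]
  by (intro endo.linear_compose_scale_right endo.linear_compose_sum ballI rho_funpow_linear)

lemma component_0 [simp]: "component u 0 = 0"
  by (rule endo.linear_0[OF component_linear])

lemma sum_powers_root_of_unity:
  fixes x :: 'k
  assumes "x ^ m = 1"
  shows "(\<Sum>j<m. x ^ j) = (if x = 1 then of_nat m else 0)"
  using assms by (simp add: geometric_sum)

lemma component_eigenvector:
  assumes "\<rho> y = scale (w ^ s) y"
  shows "component u y = (if [u = s] (mod m) then y else 0)"
proof -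
  define x where "x = inverse w ^ u * w ^ s"
  have iter: "(\<rho> ^^ j) y = scale ((w ^ s) ^ j) y" for j
    by (induction j) (simp_all add: assms rho_scale mult.commute)
  have "x ^ m = 1"
    by (simp add: x_def power_mult_distrib power_inverse w_m mult.commute flip: power_mult)
      (simp add: power_mult w_m)
  moreover have "x = 1 \<longleftrightarrow> [u = s] (mod m)"
    using w_nonzero by (auto simp: x_def power_inverse field_simps w_power_eq_iff cong_sym_eq)
  ultimately have "(\<Sum>j<m. x ^ j) = (if [u = s] (mod m) then of_nat m else 0)"
    by (simp add: sum_powers_root_of_unity)
  moreover have "component u y = scale (1 / of_nat m) (scale (\<Sum>j<m. x ^ j) y)"
    by (simp add: component_def iter x_def power_mult_distrib scale_sum_left)
  ultimately show ?thesis using of_nat_m_neq_0 by simp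
qed

lemma component_graded:
  "y \<in> graded_part scale \<rho> w s \<Longrightarrow> component u y = (if [u = s] (mod m) then y else 0)"
  by (simp add: graded_part_def component_eigenvector)

text \<open>Applying \<open>\<rho>\<close> shifts the summation index by one, and the sum over a full period does not change.\<close>

lemma rho_component: "\<rho> (component u y) = scale (w ^ u) (component u y)"
proof -
  define a where "a j = scale ((inverse w ^ u) ^ j) ((\<rho> ^^ j) y)" for j
  have "(inverse w ^ u) ^ m = (inverse w ^ m) ^ u"
    by (simp add: mult.commute flip: power_mult)
  then have "a m = a 0"
    by (simp add: a_def rho_period power_inverse w_m)
  then have shift: "(\<Sum>j<m. a (Suc j)) = (\<Sum>j<m. a j)"
    by (metis add.commute add_right_cancel sum.lessThan_Suc sum.lessThan_Suc_shift)
  have step: "\<rho> (a j) = scale (w ^ u) (a (Suc j))" for j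
    using w_nonzero by (simp add: a_def rho_scale power_inverse)
  have "\<rho> (component u y) = scale (1 / of_nat m) (\<Sum>j<m. \<rho> (a j))"
    by (simp add: component_def a_def rho_scale endo.linear_sum[OF rho_linear])
  also have "\<dots> = scale (w ^ u) (scale (1 / of_nat m) (\<Sum>j<m. a (Suc j)))"
    by (simp only: step flip: scale_sum_right) (rule scale_left_commute)
  finally show ?thesis unfolding shift by (simp add: component_def a_def)
qed

lemma component_in_graded_part: "component u y \<in> graded_part scale \<rho> w u"
  by (simp add: graded_part_def rho_component)

lemma sum_components: "(\<Sum>u<m. component u y) = y"
proof -
  have "(inverse w ^ j) ^ m = (inverse w ^ m) ^ j" for j
    by (simp add: mult.commute flip: power_mult)
  then have root: "(inverse w ^ j) ^ m = 1" for j
    by (simp add: power_inverse w_m)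
  have one: "inverse w ^ j = 1 \<longleftrightarrow> j = 0" if "j < m" for j
    using w_power_eq_iff[of j 0] that by (simp add: power_inverse cong_def)
  have "(\<Sum>u<m. component u y) =
      scale (1 / of_nat m) (\<Sum>j<m. \<Sum>u<m. scale ((inverse w ^ u) ^ j) ((\<rho> ^^ j) y))"
    unfolding component_def by (subst sum.swap) (simp add: scale_sum_right)
  also have "\<dots> = scale (1 / of_nat m) (\<Sum>j<m. scale (\<Sum>u<m. (inverse w ^ j) ^ u) ((\<rho> ^^ j) y))"
    by (simp add: scale_sum_left mult.commute flip: power_mult)
  also have "\<dots> = scale (1 / of_nat m) (\<Sum>j<m. if j = 0 then scale (of_nat m) y else 0)"
    by (intro arg_cong[where f = "scale _"] sum.cong)
      (auto simp: sum_powers_root_of_unity[OF root] one)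
  also have "\<dots> = y" using m_pos of_nat_m_neq_0 by simp
  finally show ?thesis .
qed

text \<open>The prefix \<open>zs\<close> holds the arguments that are left as they are, which makes an induction on the
  remaining ones possible.\<close>

lemma multilinear_expand_components:
  assumes f: "multilinear scale scale n f" and len: "length zs + length xs = n"
  shows "f (zs @ xs) =
    (\<Sum>us | set us \<subseteq> {..<m} \<and> length us = length xs. f (zs @ map2 component us xs))"
  using len
proof (induction xs arbitrary: zs)
  case Nil
  have "{us :: nat list. set us \<subseteq> {..<m} \<and> length us = 0} = {[]}" by auto
  then show ?case by simp
next
  case (Cons x xs)
  let ?U = "{us. set us \<subseteq> {..<m} \<and> length us = length xs}"
  have lin: "Vector_Spaces.linear scale scale (\<lambda>x. f (zs @ x # xs))"
    using multilinearD[OF f, of "zs @ x # xs" "length zs"] Cons.prems by simp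
  have "f (zs @ x # xs) = f (zs @ (\<Sum>u<m. component u x) # xs)" by (simp add: sum_components)
  also have "\<dots> = (\<Sum>u<m. f (zs @ component u x # xs))"
    by (rule endo.linear_sum[OF lin])
  also have "\<dots> = (\<Sum>u<m. \<Sum>us\<in>?U. f (zs @ map2 component (u # us) (x # xs)))"
    using Cons.IH[of "zs @ [component _ x]"] Cons.prems by simp
  also have "\<dots> = (\<Sum>(us, u)\<in>?U \<times> {..<m}. f (zs @ map2 component (u # us) (x # xs)))"
    by (subst sum.swap) (simp only: sum.cartesian_product)
  also have "\<dots> = (\<Sum>us\<in>(\<lambda>(us, u). u # us) ` (?U \<times> {..<m}).
      f (zs @ map2 component us (x # xs)))"
    by (subst sum.reindex) (auto simp: inj_on_def case_prod_unfold)
  finally show ?case by (simp add: lists_length_Suc_eq)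
qed

lemma multilinear_eigen:
  assumes f: "multilinear scale scale n f"
    and hom: "list_all2 (\<lambda>x u. x \<in> graded_part scale \<rho> w u) xs us"
    and len: "length zs + length xs = n"
  shows "f (zs @ map \<rho> xs) = scale (w ^ sum_list us) (f (zs @ xs))"
  using hom len
proof (induction arbitrary: zs rule: list_all2_induct)
  case (Cons x xs u us)
  have lin: "Vector_Spaces.linear scale scale (\<lambda>x. f (zs @ x # map \<rho> xs))"
    using multilinearD[OF f, of "zs @ x # map \<rho> xs" "length zs"] Cons.prems by simp
  have "f (zs @ map \<rho> (x # xs)) = scale (w ^ u) (f (zs @ x # map \<rho> xs))"
    using Cons.hyps endo.linear_scale[OF lin] by (simp add: graded_part_def)
  also have "f (zs @ x # map \<rho> xs) = scale (w ^ sum_list us) (f (zs @ x # xs))"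
    using Cons.IH[of "zs @ [x]"] Cons.prems by simp
  finally show ?case by (simp add: power_add)
qed simp

lemma list_all2_components:
  "length us = length xs \<Longrightarrow> list_all2 (\<lambda>x u. x \<in> graded_part scale \<rho> w u) (map2 component us xs) us"
  by (induction us xs rule: list_induct2) (auto simp: component_in_graded_part)

lemma degree_indices_0_iff:
  "(us, v) \<in> degree_indices m 0 n \<longleftrightarrow>
     (set us \<subseteq> {..<m} \<and> length us = n) \<and> v < m \<and> [v = sum_list us] (mod m)"
proof -
  have "(\<Sum>u\<leftarrow>us. int u) = int (sum_list us)" by (induction us) auto
  moreover have "[int v - int s = 0] (mod int m) \<longleftrightarrow> [v = s] (mod m)" for s
    by (simp add: cong_iff_dvd_diff cong_int_iff[symmetric])
  ultimately show ?thesis by (auto simp: degree_indices_def)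
qed

text \<open>On homogeneous arguments of degrees \<open>us\<close> both sides multiply the value by the same root of unity,
  since \<open>w\<^sup>v\<close> is \<open>w\<close> to the sum of \<open>us\<close>; on homogeneous arguments of other degrees \<open>g\<close> vanishes.
  Multilinearity extends this to all arguments.\<close>

lemma homogeneous_component_invariant:
  assumes g: "g \<in> homogeneous_component scale \<rho> w m us v"
    and idx: "(us, v) \<in> degree_indices m 0 n"
  shows "\<rho> (g xs) = g (map \<rho> xs)"
proof (cases "length xs = n")
  case True
  have len: "length us = n" and vs: "w ^ v = w ^ sum_list us"
    using idx by (auto simp: degree_indices_0_iff w_power_eq_iff)
  then have gc: "multilinear scale scale n g"
    using g by (simp add: homogeneous_component_def cochains_iff)
  have lin1: "multilinear scale scale n (\<lambda>xs. \<rho> (g xs))"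
    using gc rho_linear by (rule multilinear_compose)
  have lin2: "multilinear scale scale n (\<lambda>xs. g (map \<rho> xs))"
    using gc rho_linear by (rule multilinear_map)
  have agree: "\<rho> (g (map2 component us' xs)) = g (map \<rho> (map2 component us' xs))"
    if us': "set us' \<subseteq> {..<m}" "length us' = length xs" for us'
  proof -
    let ?ys = "map2 component us' xs"
    have hom: "list_all2 (\<lambda>x u. x \<in> graded_part scale \<rho> w u) ?ys us'"
      using us' by (simp add: list_all2_components)
    then have val: "if us' = us then g ?ys \<in> graded_part scale \<rho> w v else g ?ys = 0"
      using g us' True len unfolding homogeneous_component_def by auto
    have "g (map \<rho> ?ys) = scale (w ^ sum_list us') (g ?ys)"
      using multilinear_eigen[OF gc hom, of "[]"] us' True by simp
    with val show ?thesis
      using vs endo.linear_0[OF rho_linear] by (auto simp: graded_part_def split: if_splits)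
  qed
  let ?U = "{us'. set us' \<subseteq> {..<m} \<and> length us' = length xs}"
  have "\<rho> (g xs) = (\<Sum>us'\<in>?U. \<rho> (g (map2 component us' xs)))"
    using multilinear_expand_components[OF lin1, of "[]" xs] True by simp
  also have "\<dots> = (\<Sum>us'\<in>?U. g (map \<rho> (map2 component us' xs)))"
    by (rule sum.cong) (auto simp: agree simp del: map_map)
  also have "\<dots> = g (map \<rho> xs)"
    using multilinear_expand_components[OF lin2, of "[]" xs] True by simp
  finally show ?thesis .
next
  case False
  then have "g ys = 0" if "length ys = length xs" for ys
    using that g idx by (auto simp: homogeneous_component_def cochains_def degree_indices_0_iff)
  then show ?thesis using endo.linear_0[OF rho_linear] by simp
qed

text \<open>The homogeneous piece of \<open>f\<close> that maps degrees \<open>us\<close> to degree \<open>v\<close>. Lists of other lengths need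
  the value \<open>0\<close> explicitly, since pairing two lists cuts the longer one off.\<close>

definition block :: "('a list \<Rightarrow> 'a) \<Rightarrow> nat list \<Rightarrow> nat \<Rightarrow> 'a list \<Rightarrow> 'a" where
  "block f us v xs =
     (if length xs = length us then component v (f (map2 component us xs)) else 0)"

lemma block_homogeneous:
  assumes f: "multilinear scale scale (length us) f" and us: "set us \<subseteq> {..<m}"
  shows "block f us v \<in> homogeneous_component scale \<rho> w m us v"
proof -
  have upd: "map2 component us (xs[i := x]) = (map2 component us xs)[i := component (us ! i) x]"
    if "length xs = length us" "i < length us" for xs i x
    using that by (intro nth_equalityI) (auto simp: nth_list_update)
  have "multilinear scale scale (length us) (block f us v)"
  proof (rule multilinearI)
    fix xs :: "'a list" and i
    assume len: "length xs = length us" "i < length us"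
    then have "Vector_Spaces.linear scale scale (\<lambda>x. f ((map2 component us xs)[i := x]))"
      using f by (simp add: multilinear_def)
    from Vector_Spaces.linear_compose[OF
        Vector_Spaces.linear_compose[OF component_linear[of "us ! i"] this] component_linear[of v]]
    show "Vector_Spaces.linear scale scale (\<lambda>x. block f us v (xs[i := x]))"
      using len by (simp add: block_def upd comp_def)
  qed
  then have "block f us v \<in> cochains scale (length us)"
    by (simp add: cochains_iff block_def)
  moreover have "if us' = us then block f us v xs \<in> graded_part scale \<rho> w v
      else block f us v xs = 0"
    if us': "length us' = length us" "set us' \<subseteq> {..<m}"
      "list_all2 (\<lambda>x u. x \<in> graded_part scale \<rho> w u) xs us'" for us' xs
  proof (cases "us' = us")
    case True
    then show ?thesis using us' component_in_graded_part
      by (auto simp: block_def graded_part_def endo.linear_0[OF rho_linear])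
  next
    case False
    then obtain i where i: "i < length us" "us ! i \<noteq> us' ! i"
      using us' by (metis nth_equalityI)
    let ?ys = "map2 component us xs"
    have len: "length xs = length us" using us' by (simp add: list_all2_lengthD)
    have "us ! i < m" "us' ! i < m" using i us us' by (auto simp: subset_iff in_set_conv_nth)
    then have "\<not> [us ! i = us' ! i] (mod m)" using i by (simp add: cong_def)
    moreover have "xs ! i \<in> graded_part scale \<rho> w (us' ! i)"
      using us' i by (simp add: list_all2_conv_all_nth)
    ultimately have "?ys ! i = 0"
      using i len by (simp add: component_graded)
    then have "?ys = ?ys[i := 0]" by (metis list_update_id)
    moreover have "f (?ys[i := 0]) = 0"
      using endo.linear_0[OF multilinearD[OF f, of ?ys i]] i len by simp
    ultimately show ?thesis using False by (simp add: block_def)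
  qed
  ultimately show ?thesis unfolding homogeneous_component_def by blast
qed

text \<open>An invariant cochain is the sum of all its blocks, and a block whose indices do not have total
  degree \<open>0\<close> vanishes: its value on homogeneous arguments of degrees \<open>us\<close> is an
  eigenvector for \<open>w\<close> to the sum of \<open>us\<close>, so its component of degree \<open>v\<close> is \<open>0\<close>.\<close>

lemma cochains_deg_0:
  "cochains_deg scale \<rho> w m 0 n = {f \<in> cochains scale n. \<forall>xs. \<rho> (f xs) = f (map \<rho> xs)}"
proof (intro equalityI subsetI CollectI conjI allI)
  fix f assume "f \<in> cochains_deg scale \<rho> w m 0 n"
  then obtain g where
    g: "\<And>us v. (us, v) \<in> degree_indices m 0 n \<Longrightarrow> g us v \<in> homogeneous_component scale \<rho> w m us v"
    and f: "f = (\<lambda>xs. \<Sum>(us, v)\<in>degree_indices m 0 n. g us v xs)"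
    unfolding cochains_deg_def by blast
  have "(\<Sum>(us, v)\<in>degree_indices m 0 n. g us v) \<in> cochains scale n"
  proof (rule cochain.subspace_sum[OF subspace_cochains], clarify)
    fix us v assume "(us, v) \<in> degree_indices m 0 n"
    with g[OF this] show "g us v \<in> cochains scale n"
      by (auto simp: homogeneous_component_def degree_indices_0_iff)
  qed
  also have "(\<Sum>(us, v)\<in>degree_indices m 0 n. g us v) = f"
    by (simp add: f fun_eq_iff sum_fun_apply case_prod_unfold)
  finally show "f \<in> cochains scale n" .
  fix xs
  show "\<rho> (f xs) = f (map \<rho> xs)"
    unfolding f endo.linear_sum[OF rho_linear]
    by (rule sum.cong) (auto dest: g intro: homogeneous_component_invariant)
next
  fix f assume "f \<in> {f \<in> cochains scale n. \<forall>xs. \<rho> (f xs) = f (map \<rho> xs)}"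
  then have fc: "f \<in> cochains scale n" and inv: "\<And>xs. \<rho> (f xs) = f (map \<rho> xs)" by auto
  then have fm: "multilinear scale scale n f" by (simp add: cochains_iff)
  let ?U = "{us :: nat list. set us \<subseteq> {..<m} \<and> length us = n}"
  have fin: "finite ?U" by (rule finite_lists_length_eq) simp
  have "f xs = (\<Sum>(us, v)\<in>degree_indices m 0 n. block f us v xs)" for xs
  proof (cases "length xs = n")
    case True
    have vanish: "component v (f (map2 component us xs)) = 0"
      if "us \<in> ?U" "v < m" "(us, v) \<notin> degree_indices m 0 n" for us v
    proof -
      have "\<rho> (f (map2 component us xs)) = scale (w ^ sum_list us) (f (map2 component us xs))"
        using multilinear_eigen[OF fm list_all2_components[of us xs], of "[]"] that True
        by (simp add: inv)
      then show ?thesis using that by (simp add: component_eigenvector[of _ "sum_list us"] degree_indices_0_iff)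
    qed
    have "f xs = (\<Sum>us\<in>?U. f (map2 component us xs))"
      using multilinear_expand_components[OF fm, of "[]" xs] True by simp
    also have "\<dots> = (\<Sum>us\<in>?U. \<Sum>v<m. component v (f (map2 component us xs)))"
      by (simp add: sum_components)
    also have "\<dots> = (\<Sum>(us, v)\<in>?U \<times> {..<m}. component v (f (map2 component us xs)))"
      by (rule sum.cartesian_product)
    also have "\<dots> = (\<Sum>(us, v)\<in>degree_indices m 0 n. component v (f (map2 component us xs)))"
      by (rule sum.mono_neutral_right) (use fin vanish in \<open>auto simp: degree_indices_0_iff\<close>)
    also have "\<dots> = (\<Sum>(us, v)\<in>degree_indices m 0 n. block f us v xs)"
      by (rule sum.cong) (auto simp: block_def degree_indices_0_iff True)
    finally show ?thesis .
  next
    case False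
    then have "(\<Sum>(us, v)\<in>degree_indices m 0 n. block f us v xs) = 0"
      by (intro sum.neutral) (auto simp: block_def degree_indices_0_iff)
    then show ?thesis using False fc by (simp add: cochains_iff)
  qed
  moreover have "\<forall>(us, v)\<in>degree_indices m 0 n. block f us v \<in> homogeneous_component scale \<rho> w m us v"
    using fm by (auto simp: degree_indices_0_iff intro: block_homogeneous)
  ultimately show "f \<in> cochains_deg scale \<rho> w m 0 n"
    unfolding cochains_deg_def by blast
qed

section \<open>Averaging over the powers of the automorphism\<close>

lemmas twist_scale = cochain_pair.linear_scale[OF twist_linear]
  and twist_sum = cochain_pair.linear_sum[OF twist_linear]

lemma twist_funpow_apply: "(twist ^^ j) f xs = (inv \<rho> ^^ j) (f (map (\<rho> ^^ j) xs))"
  by (induction j arbitrary: xs) (simp_all add: twist_def funpow_swap1[of \<rho>] comp_def)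

lemma twist_period: "(twist ^^ m) f = f"
  using inv_fn[OF rho_bij, of m] by (simp add: fun_eq_iff twist_funpow_apply rho_period)

definition average :: "('a list \<Rightarrow> 'a) \<Rightarrow> 'a list \<Rightarrow> 'a" where
  "average f = (\<lambda>xs. scale (1 / of_nat m) ((\<Sum>j<m. (twist ^^ j) f) xs))"

lemma twist_average: "twist (average f) = average f"
proof -
  have "(\<Sum>j<m. (twist ^^ Suc j) f) = (\<Sum>j<m. (twist ^^ j) f)"
    using sum.lessThan_Suc_shift[of "\<lambda>j. (twist ^^ j) f" m]
    by (simp add: twist_period)
  then show ?thesis
    unfolding average_def by (simp add: twist_scale twist_sum)
qed

lemma average_fixed:
  assumes "twist f = f"
  shows "average f = f"
proof -
  have "(twist ^^ j) f = f" for j by (induction j) (simp_all add: assms)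
  then show ?thesis
    using of_nat_m_neq_0 by (simp add: average_def fun_eq_iff sum_fun_apply sum_constant_scale)
qed

lemma differential_average:
  "hochschild_differential scale n (average f) = average (hochschild_differential scale n f)"
proof -
  have "hochschild_differential scale n ((twist ^^ j) f) = (twist ^^ j) (hochschild_differential scale n f)" for j
    by (induction j) (simp_all add: differential_twist)
  then show ?thesis by (simp add: average_def differential_scale differential_sum)
qed

lemma average_cochain:
  assumes "f \<in> cochains scale n"
  shows "average f \<in> cochains scale n"
proof -
  have "(twist ^^ j) f \<in> cochains scale n" for j
    by (induction j) (simp_all add: assms twist_cochain)
  then show ?thesis
    unfolding average_def
    by (intro cochain.subspace_scale cochain.subspace_sum subspace_cochains)
qed

lemma cochains_deg_0_iff:
  "f \<in> cochains_deg scale \<rho> w m 0 n \<longleftrightarrow> f \<in> cochains scale n \<and> twist f = f"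
  by (simp add: cochains_deg_0 twist_fixed_iff)

lemma subspace_cochains_deg_0: "cochain.subspace (cochains_deg scale \<rho> w m 0 n)"
  using subspace_cochains[of n] cochain_pair.linear_0[OF twist_linear]
    cochain_pair.linear_add[OF twist_linear] twist_scale
  unfolding cochain.subspace_def by (simp add: cochains_deg_0_iff)

text \<open>If conjugating once does not change classes, then neither does conjugating several times, and the
  average of the conjugates is in the class of \<open>f\<close>.\<close>

lemma average_cohomologous:
  assumes twist: "\<And>g. g \<in> cocycles scale (cochains scale) n
      \<Longrightarrow> g - twist g \<in> coboundaries scale (cochains scale) n"
    and f: "f \<in> cocycles scale (cochains scale) n"
  shows "f - average f \<in> coboundaries scale (cochains scale) n"
proof -
  let ?B = "coboundaries scale (cochains scale) n"
  have B: "cochain.subspace ?B" by (intro subspace_coboundaries subspace_cochains)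
  have cocycle: "(twist ^^ j) f \<in> cocycles scale (cochains scale) n" for j
  proof (induction j)
    case (Suc j)
    then show ?case
      using cochain_pair.linear_0[OF twist_linear]
      by (simp add: cocycles_def twist_cochain differential_twist)
  qed (use f in simp)
  have "f - (twist ^^ j) f \<in> ?B" for j
  proof (induction j)
    case 0
    then show ?case using cochain.subspace_0[OF B] by (simp add: zero_fun_def)
  next
    case (Suc j)
    note cochain.subspace_add[OF B Suc twist[OF cocycle[of j]]]
    also have "(f - (twist ^^ j) f) + ((twist ^^ j) f - twist ((twist ^^ j) f)) =
        f - (twist ^^ Suc j) f"
      by simp
    finally show ?case .
  qed
  then have "(\<lambda>xs. scale (1 / of_nat m) ((\<Sum>j<m. f - (twist ^^ j) f) xs)) \<in> ?B"
    by (intro cochain.subspace_scale[OF B] cochain.subspace_sum[OF B])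
  also have "(\<lambda>xs. scale (1 / of_nat m) ((\<Sum>j<m. f - (twist ^^ j) f) xs)) = f - average f"
    using of_nat_m_neq_0
    by (simp add: average_def fun_eq_iff sum_fun_apply sum_subtractf scale_right_diff_distrib
        sum_constant_scale)
  finally show ?thesis .
qed

end

section \<open>Hochschild cohomology of a Frobenius algebra\<close>

theorem theoremA:
  fixes scale :: "'k::field \<Rightarrow> 'a::{ring, monoid_mult} \<Rightarrow> 'a"
    and \<phi> :: "'a \<Rightarrow> 'k" and \<rho> :: "'a \<Rightarrow> 'a" and m :: nat and w :: 'k and n :: nat
  assumes "finite_dimensional_algebra scale"
    and "frobenius_homomorphism scale \<phi>"
    and "nakayama_automorphism scale \<phi> \<rho>"
    and "has_order \<rho> m"
    and "primitive_root_of_unity m w"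
  shows "cohomology_iso scale (cochains_deg scale \<rho> w m 0) (cochains scale) n
           (inclusion_map scale (cochains scale) n)"
proof -
  interpret finite_dimensional_algebra scale by fact
  interpret frobenius_algebra_with_nakayama scale \<phi> \<rho>
    by unfold_locales fact+
  interpret diagonalizable_automorphism scale \<rho> m w
    using assms(4,5) by unfold_locales (simp_all add: has_order_def)
  show ?thesis
  proof (rule inclusion_cohomology_iso)
    fix f assume f: "f \<in> cocycles scale (cochains_deg scale \<rho> w m 0) n"
      and "f \<in> coboundaries scale (cochains scale) n"
    then show "f \<in> coboundaries scale (cochains_deg scale \<rho> w m 0) n"
    proof (cases n)
      case (Suc k)
      with \<open>f \<in> coboundaries scale (cochains scale) n\<close>
      obtain h where h: "h \<in> cochains scale k" "f = hochschild_differential scale k h" by auto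
      \<comment> \<open>The cochain \<open>f\<close> is invariant and averaging commutes with the differential, so a primitive of \<open>f\<close> may be averaged.\<close>
      have "f = average f"
        using f by (simp add: cocycles_def cochains_deg_0_iff average_fixed)
      also have "\<dots> = hochschild_differential scale k (average h)"
        by (simp add: h differential_average)
      finally show ?thesis
        using h Suc by (auto simp: cochains_deg_0_iff average_cochain twist_average)
    qed simp
  next
    fix f assume f: "f \<in> cocycles scale (cochains scale) n"
    have "average f \<in> cocycles scale (cochains_deg scale \<rho> w m 0) n"
      using f average_fixed[of 0] cochain_pair.linear_0[OF twist_linear]
      by (auto simp: cocycles_def cochains_deg_0_iff average_cochain twist_average
          differential_average)
    then show "\<exists>g\<in>cocycles scale (cochains_deg scale \<rho> w m 0) n.
        f - g \<in> coboundaries scale (cochains scale) n"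
      using average_cohomologous[OF twist_cocycle_cohomologous f] by blast
  qed (auto simp: subspace_cochains subspace_cochains_deg_0 cochains_deg_0_iff)
qed

end
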